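(* Let $m \in \mathbb{N}$ and let $N_1,\dots,N_m, nv_m, dv_m, snv_m, sdv_m \in \mathbb{N}$ satisfy $$\begin{bmatrix} nv_m & snv_m\\ dv_m & sdv_m \end{bmatrix} = \begin{bmatrix} 0 & 1\\ 1 & 0 \end{bmatrix} \prod_{k=1}^{m} \begin{bmatrix} 1 & 1\\ N_k & N_k+1 \end{bmatrix}.$$ Then: (i) $\dfrac{nv_m}{dv_m} = \mathbb{Q}_{[\circ N_1 \circ \cdots \circ N_m]}$; (ii) $\dfrac{snv_m}{sdv_m} = \mathbb{Q}_{[\circ N_1 \circ \cdots \circ N_{m-1} \circ (N_m+1)]}$; (iii) for every real $\delta > 0$, $\dfrac{nv_m + \delta\, snv_m}{dv_m + \delta\, sdv_m} = \mathbb{Q}_{[\circ N_1 \circ \cdots \circ N_m \circ \delta]}$. Moreover, the rational key $nv_m/dv_m$ of a tree node is unique to that node: if $(N_1,\dots,N_m)$ and $(N'_1,\dots,N'_{m'})$ are distinct nonempty finite sequences in $\mathbb{N}$ (with $m, m' \in \mathbb{N}$ possibly different), and $$\begin{bmatrix} nv & snv\\ dv & sdv \end{bmatrix} = \begin{bmatrix} 0 & 1\\ 1 & 0 \end{bmatrix} \prod_{k=1}^{m} \begin{bmatrix} 1 & 1\\ N_k & N_k+1 \end{bmatrix}, \qquad \begin{bmatrix} nv' & snv'\\ dv' & sdv' \end{bmatrix} = \begin{bmatrix} 0 & 1\\ 1 & 0 \end{bmatrix} \prod_{k=1}^{m'} \begin{bmatrix} 1 & 1\\ N'_k & N'_k+1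 \end{bmatrix},$$ then the fractions $nv/dv$ and $nv'/dv'$ are different.
   Context: $\mathbb{N}$ denotes the positive integers. The product $\prod_{k=1}^m M_k$ of $2\times 2$ matrices is taken in the order $M_1 M_2 \cdots M_m$. Tree nodes (positions in a rooted, ordered tree) are identified with nonempty finite sequences $[\circ N_1 \circ \cdots \circ N_m]$ of positive integers, meaning the $N_m$-th child of the $\dots$ of the $N_2$-th child of the $N_1$-th top-level node. For $n \ge 1$ and positive real numbers $N_1,\dots,N_n$, the quantity $\mathbb{Q}_{[\circ N_1 \circ \cdots \circ N_n]}$ is the finite continued fraction with the $2n-1$ terms $N_1, 1, N_2, 1, \dots, 1, N_n$ (all partial numerators equal to 1): $$\mathbb{Q}_{[\circ N_1 \circ \cdots \circ N_n]} = N_1 + \cfrac{1}{1+\cfrac{1}{N_2+\cfrac{1}{1+\cfrac{1}{\ddots + \cfrac{1}{1+\cfrac{1}{N_n}}}}}}.$$ Equivalently, $\mathbb{Q}_{[\circ N_1]} = N_1$ and, for $n\ge 2$, $\mathbb{Q}_{[\circ N_1 \circ N_2 \circ \cdots \circ N_n]} = N_1 + \dfrac{1}{1 + 1/\mathbb{Q}_{[\circ N_2 \circ \cdots \circ N_n]}}$. For $m=1$ the right-hand side of (ii) is $\mathbb{Q}_{[\circ (N_1+1)]}$. *)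

theory Defs
  imports "HOL-Analysis.Analysis"
begin

text \<open>Finite continued fraction with the given terms, all partial numerators being 1.
  The value on the empty list is junk.\<close>

fun cfrac :: "real list \<Rightarrow> real" where
  "cfrac [] = 0"
| "cfrac [x] = x"
| "cfrac (x # y # ys) = x + 1 / cfrac (y # ys)"

text \<open>\<open>splice\<close> alternates its arguments, so the terms are \<open>N\<^sub>1, 1, N\<^sub>2, 1, \<dots>, 1, N\<^sub>n\<close>.\<close>

definition tree_frac :: "real list \<Rightarrow> real" where
  "tree_frac Ns = cfrac (splice Ns (replicate (length Ns - 1) 1))"

lemma tree_frac_single: "tree_frac [x] = x"
  by (simp add: tree_frac_def)

lemma tree_frac_Cons:
  assumes "Ns \<noteq> []"
  shows "tree_frac (x # Ns) = x + 1 / (1 + 1 / tree_frac Ns)"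
  using assms by (cases Ns) (simp_all add: tree_frac_def)

definition mat22 :: "'a \<Rightarrow> 'a \<Rightarrow> 'a \<Rightarrow> 'a \<Rightarrow> ('a::zero)^2^2" where
  "mat22 a b c d = vector [vector [a, b], vector [c, d]]"

lemma mat22_nth:
  "mat22 a b c d $ 1 $ 1 = a" "mat22 a b c d $ 1 $ 2 = b"
  "mat22 a b c d $ 2 $ 1 = c" "mat22 a b c d $ 2 $ 2 = d"
  by (simp_all add: mat22_def)

definition node_matrix :: "nat list \<Rightarrow> nat^2^2" where
  "node_matrix Ns =
     mat22 0 1 1 0 ** foldr (**) (map (\<lambda>N. mat22 1 1 N (N + 1)) Ns) (mat 1)"

text \<open>A tree node is a nonempty finite sequence of positive integers.\<close>

definition is_node :: "nat list \<Rightarrow> bool" where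
  "is_node Ns \<longleftrightarrow> Ns \<noteq> [] \<and> (\<forall>N \<in> set Ns. N > 0)"

end

theory Submission
  imports Defs
begin

text \<open>The matrix of \<open>N\<^sub>1, \<dots>, N\<^sub>m\<close> acts as the Moebius transformation
  \<open>\<delta> \<mapsto> Q[N\<^sub>1, \<dots>, N\<^sub>m, \<delta>]\<close>, which is (iii). Splitting off the last factor of
  the product, whose columns are \<open>(1, N\<^sub>m)\<close> and \<open>(1, N\<^sub>m + 1)\<close>, shows that (i) and (ii) are
  the values of the transformation of \<open>N\<^sub>1, \<dots>, N\<^bsub>m-1\<^esub>\<close> at \<open>N\<^sub>m\<close> and \<open>N\<^sub>m + 1\<close>.
  The key determines the node because \<open>N\<^sub>1\<close> is its integer part, and the map
  \<open>q \<mapsto> 1 / (1 + 1 / q)\<close> from positive reals to \<open>(0, 1)\<close> is injective.\<close>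

lemma mat22_eq_iff:
  "mat22 a b c d = mat22 a' b' c' d' \<longleftrightarrow> a = a' \<and> b = b' \<and> c = c' \<and> d = d'"
  by (metis mat22_nth)

lemma mat22_eta: "A = mat22 (A $ 1 $ 1) (A $ 1 $ 2) (A $ 2 $ 1) (A $ 2 $ 2)"
  by (simp add: vec_eq_iff forall_2 mat22_nth)

lemma mat22_mult:
  fixes a :: "'a::semiring_1"
  shows "mat22 a b c d ** mat22 a' b' c' d' =
    mat22 (a * a' + b * c') (a * b' + b * d') (c * a' + d * c') (c * b' + d * d')"
  by (simp add: vec_eq_iff forall_2 mat22_nth matrix_matrix_mult_def sum_2)

lemma node_matrix_Nil: "node_matrix [] = mat22 0 1 1 0"
  by (simp add: node_matrix_def del: One_nat_def)

text \<open>The leading swap matrix exchanges the rows of the product, so a factor prepended to the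
  product lands between the swap and the old factors; undoing the swap on the old matrix gives the
  recursion.\<close>

lemma node_matrix_Cons:
  assumes "node_matrix Ns = mat22 p q r s"
  shows "node_matrix (N # Ns) = mat22 (N * (p + r) + p) (N * (q + s) + q) (p + r) (q + s)"
proof -
  obtain a b c d where P:
    "foldr (**) (map (\<lambda>N. mat22 1 1 N (N + 1)) Ns) (mat 1) = mat22 a b c d"
    using mat22_eta by blast
  then have "p = c" "q = d" "r = a" "s = b"
    using assms by (simp_all add: node_matrix_def mat22_mult mat22_eq_iff)
  with P show ?thesis
    by (simp add: node_matrix_def mat22_mult mat22_eq_iff algebra_simps)
qed

lemma node_matrix_snoc:
  "node_matrix (Ns @ [N]) = node_matrix Ns ** mat22 1 1 N (N + 1)"
proof -
  \<comment> \<open>An appended factor becomes the start value of \<open>foldr\<close>;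
    associativity pulls it out to the right.\<close>
  have "foldr (**) Ms A = foldr (**) Ms (mat 1) ** A" for Ms :: "(nat^2^2) list" and A
    by (induction Ms) (simp_all add: matrix_mul_assoc del: One_nat_def)
  from this[of _ "mat22 1 1 N (N + 1)"] show ?thesis
    by (simp add: node_matrix_def matrix_mul_assoc del: One_nat_def)
qed

text \<open>Only \<open>q\<close> and \<open>r\<close> are claimed positive, since the swap matrix
  of the empty sequence has a zero diagonal. This suffices for \<open>p + \<delta> * q\<close> and
  \<open>r + \<delta> * s\<close> to be positive when \<open>\<delta> > 0\<close>.\<close>

lemma node_matrix_pos:
  assumes "node_matrix Ns = mat22 p q r s"
  shows "q > 0 \<and> r > 0"
  using assms
proof (induction Ns arbitrary: p q r s)
  case Nil
  then show ?case by (simp add: node_matrix_Nil mat22_eq_iff)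
next
  case (Cons N Ns)
  obtain p' q' r' s' where "node_matrix Ns = mat22 p' q' r' s'"
    using mat22_eta by blast
  with Cons show ?case
    by (force simp: mat22_eq_iff dest: node_matrix_Cons[of Ns _ _ _ _ N])
qed

text \<open>Induction from the front: the empty sequence gives the identity map, and prepending
  \<open>N\<close> sends a value \<open>x / y\<close> to \<open>N + x / (x + y)\<close>.\<close>

lemma tree_frac_snoc_eq:
  assumes "node_matrix Ns = mat22 p q r s" and "\<delta> > 0"
  shows "tree_frac (map real Ns @ [\<delta>]) = (real p + \<delta> * real q) / (real r + \<delta> * real s)"
  using assms(1)
proof (induction Ns arbitrary: p q r s)
  case Nil
  then show ?case by (auto simp: node_matrix_Nil mat22_eq_iff tree_frac_single)
next
  case (Cons N Ns)
  obtain p' q' r' s' where Ns: "node_matrix Ns = mat22 p' q' r' s'"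
    using mat22_eta by blast
  have "q' > 0" "r' > 0"
    using node_matrix_pos[OF Ns] by auto
  then have pos: "real p' + \<delta> * real q' > 0" "real r' + \<delta> * real s' > 0"
    using \<open>\<delta> > 0\<close> by (simp_all add: add_nonneg_pos add_pos_nonneg)
  have entries: "p = N * (p' + r') + p'" "q = N * (q' + s') + q'" "r = p' + r'" "s = q' + s'"
    using Cons.prems unfolding node_matrix_Cons[OF Ns] mat22_eq_iff by blast+
  define x y where "x = real p' + \<delta> * real q'" and "y = real r' + \<delta> * real s'"
  have "tree_frac (map real (N # Ns) @ [\<delta>]) = real N + 1 / (1 + 1 / (x / y))"
    using Cons.IH[OF Ns] by (simp add: tree_frac_Cons x_def y_def)
  also have "\<dots> = (real N * (x + y) + x) / (x + y)"
    using pos unfolding x_def[symmetric] y_def[symmetric]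
    by (simp add: divide_simps)
  also have "\<dots> = (real p + \<delta> * real q) / (real r + \<delta> * real s)"
    by (simp add: entries x_def y_def algebra_simps)
  finally show ?case .
qed

lemma tree_frac_node:
  assumes "is_node Ns" and "node_matrix Ns = mat22 p q r s"
  shows "tree_frac (map real Ns) = real p / real r"
    and "tree_frac (map real (butlast Ns @ [last Ns + 1])) = real q / real s"
proof -
  \<comment> \<open>\<open>Ms\<close> is empty for a node of length one, a case that
    \<open>tree_frac_snoc_eq\<close> covers.\<close>
  obtain Ms N where Ns: "Ns = Ms @ [N]" and "N > 0"
    using assms(1) by (cases Ns rule: rev_cases) (auto simp: is_node_def)
  obtain p' q' r' s' where Ms: "node_matrix Ms = mat22 p' q' r' s'"
    using mat22_eta by blast
  have entries: "p = p' + N * q'" "q = p' + (N + 1) * q'" "r = r' + N * s'" "s = r' + (N + 1) * s'"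
    using assms(2) by (simp_all add: Ns node_matrix_snoc Ms mat22_mult mat22_eq_iff mult.commute)
  show "tree_frac (map real Ns) = real p / real r"
    using tree_frac_snoc_eq[OF Ms, of "real N"] \<open>N > 0\<close> by (simp add: Ns entries)
  show "tree_frac (map real (butlast Ns @ [last Ns + 1])) = real q / real s"
    using tree_frac_snoc_eq[OF Ms, of "real (N + 1)"] by (simp add: Ns entries algebra_simps)
qed

lemma is_node_Cons: "is_node (N # Ns) \<longleftrightarrow> N > 0 \<and> (Ns = [] \<or> is_node Ns)"
  by (auto simp: is_node_def)

lemma tree_frac_pos:
  assumes "is_node Ns"
  shows "tree_frac (map real Ns) > 0"
  using assms
proof (induction Ns)
  case Nil
  then show ?case by (simp add: is_node_def)
next
  case (Cons N Ns)
  then show ?case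
    by (cases "Ns = []")
      (auto simp: is_node_Cons tree_frac_single tree_frac_Cons intro!: add_pos_pos divide_pos_pos)
qed

text \<open>The value 0 at the empty sequence is not a junk value: it makes the tail of a node
  recoverable also when the node has length one.\<close>

definition node_tail :: "nat list \<Rightarrow> real" where
  "node_tail Ns = (if Ns = [] then 0 else 1 / (1 + 1 / tree_frac (map real Ns)))"

lemma tree_frac_eq_node_tail: "tree_frac (map real (N # Ns)) = real N + node_tail Ns"
  by (simp add: node_tail_def tree_frac_single tree_frac_Cons)

text \<open>By these bounds \<open>node_tail\<close> is the fractional part of a key, and it
  vanishes exactly at nodes of length one.\<close>

lemma node_tail_bounds:
  assumes "Ns = [] \<or> is_node Ns"
  shows "0 \<le> node_tail Ns" "node_tail Ns < 1" "node_tail Ns = 0 \<longleftrightarrow> Ns = []"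
proof -
  have "0 < node_tail Ns \<and> node_tail Ns < 1" if "is_node Ns"
  proof -
    have "1 / tree_frac (map real Ns) > 0" "Ns \<noteq> []"
      using tree_frac_pos[OF that] that by (auto simp: is_node_def)
    then show ?thesis by (simp add: node_tail_def add_pos_pos)
  qed
  with assms show "0 \<le> node_tail Ns" "node_tail Ns < 1" "node_tail Ns = 0 \<longleftrightarrow> Ns = []"
    by (auto simp: node_tail_def)
qed

lemma tree_frac_inj:
  assumes "is_node Ns" "is_node Ms" "tree_frac (map real Ns) = tree_frac (map real Ms)"
  shows "Ns = Ms"
  using assms
proof (induction Ns arbitrary: Ms)
  case Nil
  then show ?case by (simp add: is_node_def)
next
  case (Cons N Ns)
  obtain M Ms' where Ms: "Ms = M # Ms'"
    using Cons.prems(2) by (cases Ms) (auto simp: is_node_def)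
  have tails: "Ns = [] \<or> is_node Ns" "Ms' = [] \<or> is_node Ms'"
    using Cons.prems by (auto simp: Ms is_node_Cons)
  have eq: "real N + node_tail Ns = real M + node_tail Ms'"
    using Cons.prems(3) by (simp only: Ms tree_frac_eq_node_tail)
  \<comment> \<open>Both tails lie in [0, 1), so the integers \<open>N\<close> and \<open>M\<close>
    differ by less than 1.\<close>
  with node_tail_bounds(1,2)[OF tails(1)] node_tail_bounds(1,2)[OF tails(2)]
  have "N = M" by linarith
  with eq have tail_eq: "node_tail Ns = node_tail Ms'" by simp
  have "Ns = Ms'"
  proof (cases "Ns = []")
    case True
    then show ?thesis
      using tail_eq node_tail_bounds(3)[OF tails(2)] by (simp add: node_tail_def)
  next
    case False
    then have "Ms' \<noteq> []"
      using tail_eq node_tail_bounds(3)[OF tails(1)] by (auto simp: node_tail_def)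
    with False tails have nodes: "is_node Ns" "is_node Ms'" by auto
    have "tree_frac (map real Ns) = tree_frac (map real Ms')"
      using tail_eq False \<open>Ms' \<noteq> []\<close> by (simp add: node_tail_def)
    with Cons.IH nodes show ?thesis by blast
  qed
  with \<open>N = M\<close> show ?case by (simp add: Ms)
qed

theorem theorem4p3:
  "(\<forall>(Ns :: nat list) (nv :: nat) (dv :: nat) (snv :: nat) (sdv :: nat).
      is_node Ns \<and> nv > 0 \<and> dv > 0 \<and> snv > 0 \<and> sdv > 0 \<and>
      mat22 nv snv dv sdv = node_matrix Ns \<longrightarrow>
        real nv / real dv = tree_frac (map real Ns) \<and>
        real snv / real sdv = tree_frac (map real (butlast Ns @ [last Ns + 1])) \<and>
        (\<forall>\<delta>::real. \<delta> > 0 \<longrightarrow>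
           (real nv + \<delta> * real snv) / (real dv + \<delta> * real sdv)
             = tree_frac (map real Ns @ [\<delta>]))) \<and>
   (\<forall>(Ns :: nat list) (Ns' :: nat list)
      (nv :: nat) (dv :: nat) (snv :: nat) (sdv :: nat)
      (nv' :: nat) (dv' :: nat) (snv' :: nat) (sdv' :: nat).
      is_node Ns \<and> is_node Ns' \<and> Ns \<noteq> Ns' \<and>
      mat22 nv snv dv sdv = node_matrix Ns \<and>
      mat22 nv' snv' dv' sdv' = node_matrix Ns' \<longrightarrow>
        real nv / real dv \<noteq> real nv' / real dv')"
  using tree_frac_node tree_frac_snoc_eq tree_frac_inj by metis

end
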